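(* Let $X$ and $Y$ be two rearrangement invariant sequence spaces. Then every compact multiplier between $X$ and $Y$ is a limit of finitely-supported multipliers; that is, if $\lambda\in M(X,Y)$ and $M_\lambda\colon X\to Y$ is compact, then there are finitely supported sequences $\lambda^{(k)}$ with $\|M_\lambda-M_{\lambda^{(k)}}\|_{X\to Y}\to0$ as $k\to\infty$.
   Context: A Köthe sequence space is a Banach space $X$ that is a linear subspace of the space of all (real or complex) sequences, with $|x|\le|y|$ coordinatewise and $y\in X$ implying $x\in X$, $\|x\|_X\le\|y\|_X$, and containing all finitely supported sequences. It is rearrangement invariant if $x$ equi-measurable (w.r.t. counting measure on $\mathbb N$) with $y\in X$ implies $x\in X$ and $\|x\|_X=\|y\|_X$. $M(X,Y)=\{g:fg\in Y\ \forall f\in X\}$ with norm $\|g\|_{M(X,Y)}=\sup_{\|f\|_X\le1}\|fg\|_Y=\|M_g\|_{X\to Y}$, where $M_gf=gf$. *)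

theory Defs
  imports "HOL-Analysis.Analysis"
begin

(* The scalar field is a type 'a of class real_normed_field.  Its norm is multiplicative and
   restricts to the absolute value on the reals, so by Gelfand-Mazur the real and the complex
   numbers are, up to isometric isomorphism, its only instances.  A sequence space is a carrier
   set X of functions nat => 'a with a norm function N that is only meaningful on X. *)

(* Metric_space needs nonnegativity and symmetry on the whole type, hence the cutoff off X. *)
definition norm_dist ::
  "(nat \<Rightarrow> 'a::real_normed_field) set \<Rightarrow> ((nat \<Rightarrow> 'a) \<Rightarrow> real) \<Rightarrow> (nat \<Rightarrow> 'a) \<Rightarrow> (nat \<Rightarrow> 'a) \<Rightarrow> real"
  where "norm_dist X N x y = (if x \<in> X \<and> y \<in> X then N (\<lambda>n. x n - y n) else 0)"

locale koethe_sequence_space =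
  fixes X :: "(nat \<Rightarrow> 'a::real_normed_field) set"
    and N :: "(nat \<Rightarrow> 'a) \<Rightarrow> real"
  assumes zero_mem: "(\<lambda>n. 0) \<in> X"
    and add_mem: "x \<in> X \<Longrightarrow> y \<in> X \<Longrightarrow> (\<lambda>n. x n + y n) \<in> X"
    and scale_mem: "x \<in> X \<Longrightarrow> (\<lambda>n. c * x n) \<in> X"
    and norm_nonneg: "x \<in> X \<Longrightarrow> 0 \<le> N x"
    and norm_eq_zero: "x \<in> X \<Longrightarrow> N x = 0 \<longleftrightarrow> x = (\<lambda>n. 0)"
    and norm_scale: "x \<in> X \<Longrightarrow> N (\<lambda>n. c * x n) = norm c * N x"
    and norm_triangle: "x \<in> X \<Longrightarrow> y \<in> X \<Longrightarrow> N (\<lambda>n. x n + y n) \<le> N x + N y"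
    and complete: "Metric_space.mcomplete X (norm_dist X N)"
    and solid: "y \<in> X \<Longrightarrow> (\<And>n. norm (x n) \<le> norm (y n)) \<Longrightarrow> x \<in> X \<and> N x \<le> N y"
    and finite_support_mem: "finite {n. x n \<noteq> 0} \<Longrightarrow> x \<in> X"
begin

lemma diff_mem:
  assumes "x \<in> X" "y \<in> X"
  shows "(\<lambda>n. x n - y n) \<in> X"
  using add_mem[OF assms(1) scale_mem[OF assms(2), of "-1"]] by simp

lemma metric_space: "Metric_space X (norm_dist X N)"
proof
  fix x y
  show "0 \<le> norm_dist X N x y"
    by (simp add: norm_dist_def diff_mem norm_nonneg)
  show "norm_dist X N x y = norm_dist X N y x"
    using norm_scale[OF diff_mem, of x y "-1"] by (simp add: norm_dist_def)
next
  fix x y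
  assume "x \<in> X" "y \<in> X"
  then show "norm_dist X N x y = 0 \<longleftrightarrow> x = y"
    by (auto simp: norm_dist_def norm_eq_zero diff_mem fun_eq_iff)
next
  fix x y z
  assume "x \<in> X" "y \<in> X" "z \<in> X"
  then show "norm_dist X N x z \<le> norm_dist X N x y + norm_dist X N y z"
    using norm_triangle[OF diff_mem diff_mem, of x y y z] by (simp add: norm_dist_def)
qed

end

definition equimeasurable :: "(nat \<Rightarrow> 'a::real_normed_field) \<Rightarrow> (nat \<Rightarrow> 'a) \<Rightarrow> bool"
  where "equimeasurable x y \<longleftrightarrow>
    (\<forall>t::real\<ge>0. emeasure (count_space UNIV) {n. t < norm (x n)}
               = emeasure (count_space UNIV) {n. t < norm (y n)})"

locale ri_sequence_space = koethe_sequence_space +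
  assumes rearrangement_invariant: "y \<in> X \<Longrightarrow> equimeasurable x y \<Longrightarrow> x \<in> X \<and> N x = N y"

definition mult_op :: "(nat \<Rightarrow> 'a::real_normed_field) \<Rightarrow> (nat \<Rightarrow> 'a) \<Rightarrow> (nat \<Rightarrow> 'a)"
  where "mult_op g f = (\<lambda>n. g n * f n)"

definition multipliers ::
  "(nat \<Rightarrow> 'a::real_normed_field) set \<Rightarrow> (nat \<Rightarrow> 'a) set \<Rightarrow> (nat \<Rightarrow> 'a) set"
  where "multipliers X Y = {g. \<forall>f\<in>X. mult_op g f \<in> Y}"

definition unit_ball ::
  "(nat \<Rightarrow> 'a::real_normed_field) set \<Rightarrow> ((nat \<Rightarrow> 'a) \<Rightarrow> real) \<Rightarrow> (nat \<Rightarrow> 'a) set"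
  where "unit_ball X N = {f \<in> X. N f \<le> 1}"

(* Extended-real valued, since real suprema of unbounded sets are unspecified. *)
definition operator_norm ::
  "(nat \<Rightarrow> 'a::real_normed_field) set \<Rightarrow> ((nat \<Rightarrow> 'a) \<Rightarrow> real) \<Rightarrow> ((nat \<Rightarrow> 'a) \<Rightarrow> real)
    \<Rightarrow> ((nat \<Rightarrow> 'a) \<Rightarrow> (nat \<Rightarrow> 'a)) \<Rightarrow> ereal"
  where "operator_norm X NX NY T = (SUP f\<in>unit_ball X NX. ereal (NY (T f)))"

(* Meant for linear T from X to Y. *)
definition compact_operator ::
  "(nat \<Rightarrow> 'a::real_normed_field) set \<Rightarrow> ((nat \<Rightarrow> 'a) \<Rightarrow> real) \<Rightarrow>
   (nat \<Rightarrow> 'a) set \<Rightarrow> ((nat \<Rightarrow> 'a) \<Rightarrow> real) \<Rightarrow> ((nat \<Rightarrow> 'a) \<Rightarrow> (nat \<Rightarrow> 'a)) \<Rightarrow> bool"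
  where "compact_operator X NX Y NY T \<longleftrightarrow>
    (let \<tau> = Metric_space.mtopology Y (norm_dist Y NY)
     in compactin \<tau> (\<tau> closure_of (T ` unit_ball X NX)))"

end

theory Submission
  imports Defs
begin

text \<open>
  The approximants are the truncations of \<open>lam\<close>, so the claim is that the tails of the multiplier
  have small operator norm.  Truncating an element \<open>f\<close> of the unit ball of \<open>X\<close> to \<open>{k..}\<close> keeps it
  in the unit ball, since \<open>X\<close> is solid; hence a tail of the multiplier applied to \<open>f\<close> is again the
  image under \<open>mult_op lam\<close> of an element of the unit ball, and it vanishes on \<open>{..<k}\<close>.
  It thus suffices that in a relatively compact subset of a Koethe space the elements
  vanishing on \<open>{..<k}\<close> have uniformly small norm for large \<open>k\<close>
  (\<open>relatively_compact_small_tails\<close>).  The latter holds because otherwise there would be a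
  sequence in the set, bounded away from zero in norm, whose members vanish on longer and longer
  initial segments; a norm limit of a subsequence is also a coordinatewise limit, by
  \<open>coordinate_bound\<close>, and would have to be zero.
\<close>

context koethe_sequence_space
begin

text \<open>
  By solidity, \<open>x\<close> dominates its own restriction to a single coordinate.  As a unit vector has
  nonzero norm, the coordinate functionals are continuous.
\<close>

lemma coordinate_bound:
  assumes "x \<in> X"
  shows "norm (x n) * N (\<lambda>m. if m = n then 1 else 0) \<le> N x"
proof -
  let ?e = "\<lambda>m. if m = n then 1 else (0::'a)"
  have "?e \<in> X"
    by (rule finite_support_mem) simp
  then have "norm (x n) * N ?e = N (\<lambda>m. x n * ?e m)"
    by (simp add: norm_scale)
  also have "\<dots> \<le> N x"
    using solid[OF assms, of "\<lambda>m. x n * ?e m"] by simp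
  finally show ?thesis .
qed

lemma unit_vector_norm_pos: "0 < N (\<lambda>m. if m = n then 1 else 0)"
proof -
  let ?e = "\<lambda>m. if m = n then 1 else (0::'a)"
  have "?e \<in> X"
    by (rule finite_support_mem) simp
  moreover have "?e \<noteq> (\<lambda>m. 0)"
    by (auto simp: fun_eq_iff)
  ultimately show ?thesis
    using norm_nonneg[of ?e] norm_eq_zero[of ?e] by linarith
qed

lemma norm_tendsto_imp_coordinate_tendsto:
  assumes mem: "\<And>k. u k \<in> X" and "y \<in> X"
    and lim: "(\<lambda>k. N (\<lambda>n. u k n - y n)) \<longlonglongrightarrow> 0"
  shows "(\<lambda>k. u k n) \<longlonglongrightarrow> y n"
proof -
  let ?c = "N (\<lambda>m. if m = n then 1 else (0::'a))"
  have "norm (u k n - y n) \<le> N (\<lambda>n. u k n - y n) / ?c" for k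
    using coordinate_bound[OF diff_mem[OF mem \<open>y \<in> X\<close>], of k n] unit_vector_norm_pos[of n]
    by (simp add: pos_le_divide_eq)
  moreover have "(\<lambda>k. N (\<lambda>n. u k n - y n) / ?c) \<longlonglongrightarrow> 0"
    using tendsto_divide_zero[OF lim] .
  ultimately have "(\<lambda>k. u k n - y n) \<longlonglongrightarrow> 0"
    by (rule Lim_null_comparison[OF always_eventually[OF allI]])
  then show ?thesis
    by (rule LIM_zero_cancel)
qed

text \<open>
  If this failed, a sequence in \<open>S\<close> of norm at least \<open>\<epsilon>\<close> would tend to zero coordinatewise, and its
  subsequential norm limit could only be zero.  The bound concerns the members of \<open>S\<close> that vanish
  on \<open>{..<k}\<close>, not the tails of arbitrary members: in the space of bounded sequences the singleton
  of the constant sequence 1 is compact, but all tails of that sequence have norm 1.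
\<close>

lemma relatively_compact_small_tails:
  assumes compact: "compactin (Metric_space.mtopology X (norm_dist X N))
                     (Metric_space.mtopology X (norm_dist X N) closure_of S)"
    and "S \<subseteq> X" and "\<epsilon> > 0"
  shows "\<exists>k. \<forall>g\<in>S. (\<forall>n<k. g n = 0) \<longrightarrow> N g < \<epsilon>"
proof (rule ccontr)
  interpret M: Metric_space X "norm_dist X N"
    by (rule metric_space)
  assume "\<not> ?thesis"
  then have "\<forall>k. \<exists>g. g \<in> S \<and> (\<forall>n<k. g n = 0) \<and> \<epsilon> \<le> N g"
    by (metis not_less)
  then obtain u where u: "\<And>k. u k \<in> S" "\<And>k n. n < k \<Longrightarrow> u k n = 0" "\<And>k. \<epsilon> \<le> N (u k)"
    by metis
  have "range u \<subseteq> M.mtopology closure_of S"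
    using u(1) closure_of_subset[of S M.mtopology] \<open>S \<subseteq> X\<close> by auto
  then obtain y r where "strict_mono r"
    and lim: "limitin M.mtopology (u \<circ> r) y sequentially"
    using compact unfolding M.compactin_sequentially by meson
  have mem: "(u \<circ> r) k \<in> X" for k
    using u(1) \<open>S \<subseteq> X\<close> by auto
  have "y \<in> X" and "(\<lambda>k. norm_dist X N ((u \<circ> r) k) y) \<longlonglongrightarrow> 0"
    using lim unfolding M.limitin_metric_dist_null by auto
  then have conv: "(\<lambda>k. N (\<lambda>n. (u \<circ> r) k n - y n)) \<longlonglongrightarrow> 0"
    using mem by (simp add: norm_dist_def)
  have "y n = 0" for n
  proof (rule LIMSEQ_unique)
    show "(\<lambda>k. (u \<circ> r) k n) \<longlonglongrightarrow> y n"
      by (rule norm_tendsto_imp_coordinate_tendsto[OF mem \<open>y \<in> X\<close> conv])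
    have "\<forall>\<^sub>F k in sequentially. (u \<circ> r) k n = 0"
    proof (rule eventually_sequentiallyI)
      fix k assume "Suc n \<le> k"
      then have "n < r k"
        using seq_suble[OF \<open>strict_mono r\<close>, of k] by linarith
      then show "(u \<circ> r) k n = 0"
        by (simp add: u(2))
    qed
    then show "(\<lambda>k. (u \<circ> r) k n) \<longlonglongrightarrow> 0"
      by (rule tendsto_eventually)
  qed
  with conv have "(\<lambda>k. N (u (r k))) \<longlonglongrightarrow> 0"
    by simp
  then have "\<epsilon> \<le> 0"
    by (rule LIMSEQ_le_const) (use u(3) in auto)
  with \<open>\<epsilon> > 0\<close> show False by simp
qed

lemma tail_unit_ball:
  assumes "f \<in> unit_ball X N"
  shows "(\<lambda>n. if n < k then 0 else f n) \<in> unit_ball X N"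
proof -
  let ?g = "\<lambda>n. if n < k then 0 else f n"
  have "f \<in> X" "N f \<le> 1"
    using assms by (simp_all add: unit_ball_def)
  moreover have "norm (?g n) \<le> norm (f n)" for n
    by simp
  ultimately have "?g \<in> X" "N ?g \<le> N f"
    using solid[of f ?g] by blast+
  with \<open>N f \<le> 1\<close> show ?thesis
    by (simp add: unit_ball_def)
qed

end

theorem corollary4p11:
  fixes X Y :: "(nat \<Rightarrow> 'a::real_normed_field) set"
    and NX NY :: "(nat \<Rightarrow> 'a) \<Rightarrow> real"
    and lam :: "nat \<Rightarrow> 'a"
  assumes "ri_sequence_space X NX"
    and "ri_sequence_space Y NY"
    and "lam \<in> multipliers X Y"
    and "compact_operator X NX Y NY (mult_op lam)"
  shows "\<exists>L :: nat \<Rightarrow> nat \<Rightarrow> 'a.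
           (\<forall>k. finite {n. L k n \<noteq> 0} \<and> L k \<in> multipliers X Y) \<and>
           (\<lambda>k. operator_norm X NX NY (\<lambda>f n. mult_op lam f n - mult_op (L k) f n))
             \<longlonglongrightarrow> 0"
proof -
  interpret X: ri_sequence_space X NX by fact
  interpret Y: ri_sequence_space Y NY by fact
  define L where "L k n = (if n < k then lam n else 0)" for k n :: nat
  let ?S = "mult_op lam ` unit_ball X NX"
  let ?T = "\<lambda>k f n. mult_op lam f n - mult_op (L k) f n"
  have "?S \<subseteq> Y"
    using assms(3) by (auto simp: multipliers_def unit_ball_def)
  have tail_mem: "?T k f \<in> ?S" if "f \<in> unit_ball X NX" for k f
  proof
    show "?T k f = mult_op lam (\<lambda>n. if n < k then 0 else f n)"
      by (auto simp: L_def mult_op_def)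
    show "(\<lambda>n. if n < k then 0 else f n) \<in> unit_ball X NX"
      by (rule X.tail_unit_ball[OF that])
  qed
  have finite_support: "finite {n. L k n \<noteq> 0}" for k
    by (rule finite_subset[of _ "{..<k}"]) (auto simp: L_def)
  have "L k \<in> multipliers X Y" for k
    unfolding multipliers_def
  proof (intro CollectI ballI Y.finite_support_mem)
    fix f
    show "finite {n. mult_op (L k) f n \<noteq> 0}"
      by (rule finite_subset[OF _ finite_support[of k]]) (auto simp: mult_op_def)
  qed
  moreover have "(\<lambda>k. operator_norm X NX NY (?T k)) \<longlonglongrightarrow> 0"
  proof (rule order_tendstoI)
    fix a :: ereal
    assume "a < 0"
    have "(\<lambda>n. 0) \<in> unit_ball X NX"
      using X.zero_mem X.norm_eq_zero[OF X.zero_mem] by (simp add: unit_ball_def)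
    then have "0 \<le> operator_norm X NX NY (?T k)" for k
      unfolding operator_norm_def
      using tail_mem \<open>?S \<subseteq> Y\<close> Y.norm_nonneg by (intro SUP_upper2[where i = "\<lambda>n. 0"]) auto
    with \<open>a < 0\<close> show "\<forall>\<^sub>F k in sequentially. a < operator_norm X NX NY (?T k)"
      by (intro always_eventually allI) (rule less_le_trans)
  next
    fix a :: ereal
    assume "0 < a"
    then obtain \<epsilon> where \<epsilon>: "0 < ereal \<epsilon>" "ereal \<epsilon> < a"
      using ereal_dense2 by blast
    obtain K where K: "\<And>g. g \<in> ?S \<Longrightarrow> (\<And>n. n < K \<Longrightarrow> g n = 0) \<Longrightarrow> NY g < \<epsilon>"
      using Y.relatively_compact_small_tails[of ?S \<epsilon>] \<open>?S \<subseteq> Y\<close> \<epsilon>(1) assms(4)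
      by (auto simp: compact_operator_def Let_def)
    have "operator_norm X NX NY (?T k) \<le> ereal \<epsilon>" if "K \<le> k" for k
      unfolding operator_norm_def
    proof (rule SUP_least)
      fix f assume "f \<in> unit_ball X NX"
      then have "NY (?T k f) < \<epsilon>"
        using that by (intro K tail_mem) (simp_all add: L_def mult_op_def)
      then show "ereal (NY (?T k f)) \<le> ereal \<epsilon>"
        by simp
    qed
    then show "\<forall>\<^sub>F k in sequentially. operator_norm X NX NY (?T k) < a"
      using \<epsilon>(2) by (intro eventually_sequentiallyI[of K]) (rule le_less_trans)
  qed
  ultimately show ?thesis
    using finite_support by blast
qed

end
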